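(* The functor $(\ )^{\mathsf{gH}}:\mathsf{Hil}^{\vee}\to\mathsf{gH}$, given by $H\mapsto H^{\mathsf{gH}}$ and $f\mapsto f^{\mathsf{gH}}$, is left adjoint to the forgetful functor $\mathrm{U}:\mathsf{gH}\to\mathsf{Hil}^{\vee}$.
   Context: A Hilbert algebra is an algebra $(H,\to,1)$ of type $(2,0)$ such that for all $a,b,c\in H$: $a\to(b\to a)=1$; $(a\to(b\to c))\to((a\to b)\to(a\to c))=1$; and $a\to b=b\to a=1$ implies $a=b$. A Hilbert algebra with supremum is an algebra $(H,\vee,\to,1)$ of type $(2,2,0)$ such that $(H,\to,1)$ is a Hilbert algebra, $(H,\vee,1)$ is a join semilattice with greatest element $1$, and for all $a,b$: $a\to b=1$ iff $a\vee b=b$. $\mathsf{Hil}^{\vee}$ is the category of Hilbert algebras with supremum and homomorphisms (maps preserving $\to,1,\vee$). A generalized Heyting algebra ($gH$-algebra) is a lattice $H$ such that for all $a,b\in H$ the maximum of $\{c\in H:a\wedge c\le b\}$ exists, denoted $a\to b$; it has a greatest element $1$ and is regarded as an algebra $(H,\wedge,\vee,\to,1)$. $\mathsf{gH}$ is the category of $gH$-algebras and homomorphisms. The forgetful functor $\mathrm{U}:\mathsf{gH}\to\mathsf{Hil}^{\vee}$ forgets $\wedge$. An implicative filter of a Hilbert algebra $H$ is a subset $F\subseteq H$ with $1\in F$ and such that $a\in F$, $a\to b\in F$ imply $b\in F$. It is irreducible if it is proper and, for all implicative filters $F_1,F_2$, $F=F_1\cap F_2$ implies $F=F_1$ or $F=F_2$.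 $X(H)$ is the set of irreducible implicative filters of $H$, ordered by inclusion. For $a\in H$, $\varphi(a)=\{P\in X(H):a\in P\}$. $X(H)^+$ is the set of upsets of $(X(H),\subseteq)$, a complete Heyting algebra under $\cap,\cup$ and $U\Rightarrow V=(U\cap V^c]^c$, where $(Y]$ is the downset generated by $Y$ and $Y^c$ the complement in $X(H)$. $H^{\mathsf{gH}}$ is the $gH$-subalgebra (closed under $\cap,\cup,\Rightarrow$, top $X(H)$) of $X(H)^+$ generated by $\varphi[H]$. For a morphism $f:H\to G$ in $\mathsf{Hil}^{\vee}$, $R_f\subseteq X(G)\times X(H)$ is defined by $(P,Q)\in R_f$ iff $f^{-1}(P)\subseteq Q$, and $R_f(P)=\{Q\in X(H):(P,Q)\in R_f\}$. The map $f^{\mathsf{gH}}:H^{\mathsf{gH}}\to G^{\mathsf{gH}}$ is $f^{\mathsf{gH}}(U)=\{P\in X(G):R_f(P)\subseteq U\}$. These assignments define a functor $(\ )^{\mathsf{gH}}:\mathsf{Hil}^{\vee}\to\mathsf{gH}$. *)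

theory Defs
  imports "HOL.Hull" "HOL-Library.FuncSet"
begin

section \<open>Categories and functors\<close>

record ('o, 'm) cat =
  Obj :: "'o set"
  Hom :: "'o \<Rightarrow> 'o \<Rightarrow> 'm set"
  Id :: "'o \<Rightarrow> 'm"
  Comp :: "'o \<Rightarrow> 'o \<Rightarrow> 'o \<Rightarrow> 'm \<Rightarrow> 'm \<Rightarrow> 'm"

locale category =
  fixes C :: "('o, 'm) cat"
  assumes Id_Hom: "X \<in> Obj C \<Longrightarrow> Id C X \<in> Hom C X X"
    and Comp_Hom:
      "\<lbrakk>X \<in> Obj C; Y \<in> Obj C; Z \<in> Obj C; f \<in> Hom C X Y; g \<in> Hom C Y Z\<rbrakk>
        \<Longrightarrow> Comp C X Y Z g f \<in> Hom C X Z"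
    and Comp_Id_right:
      "\<lbrakk>X \<in> Obj C; Y \<in> Obj C; f \<in> Hom C X Y\<rbrakk> \<Longrightarrow> Comp C X X Y f (Id C X) = f"
    and Comp_Id_left:
      "\<lbrakk>X \<in> Obj C; Y \<in> Obj C; f \<in> Hom C X Y\<rbrakk> \<Longrightarrow> Comp C X Y Y (Id C Y) f = f"
    and Comp_assoc:
      "\<lbrakk>W \<in> Obj C; X \<in> Obj C; Y \<in> Obj C; Z \<in> Obj C;
        f \<in> Hom C W X; g \<in> Hom C X Y; h \<in> Hom C Y Z\<rbrakk>
        \<Longrightarrow> Comp C W X Z (Comp C X Y Z h g) f = Comp C W Y Z h (Comp C W X Y g f)"

locale cat_functor =
  C: category C + D: category D
  for C :: "('o, 'm) cat" and D :: "('p, 'n) cat" +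
  fixes F :: "'o \<Rightarrow> 'p"
    and Fm :: "'o \<Rightarrow> 'o \<Rightarrow> 'm \<Rightarrow> 'n"
  assumes F_Obj: "X \<in> Obj C \<Longrightarrow> F X \<in> Obj D"
    and Fm_Hom:
      "\<lbrakk>X \<in> Obj C; Y \<in> Obj C; f \<in> Hom C X Y\<rbrakk> \<Longrightarrow> Fm X Y f \<in> Hom D (F X) (F Y)"
    and Fm_Id: "X \<in> Obj C \<Longrightarrow> Fm X X (Id C X) = Id D (F X)"
    and Fm_Comp:
      "\<lbrakk>X \<in> Obj C; Y \<in> Obj C; Z \<in> Obj C; f \<in> Hom C X Y; g \<in> Hom C Y Z\<rbrakk>
        \<Longrightarrow> Fm X Z (Comp C X Y Z g f) = Comp D (F X) (F Y) (F Z) (Fm Y Z g) (Fm X Y f)"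


section \<open>Hilbert algebras with supremum and generalized Heyting algebras\<close>

record 'a hil =
  carrier :: "'a set"
  imp :: "'a \<Rightarrow> 'a \<Rightarrow> 'a"  (infixr \<open>\<leadsto>\<index>\<close> 60)
  unit_elt :: 'a  (\<open>\<one>\<index>\<close>)
  join :: "'a \<Rightarrow> 'a \<Rightarrow> 'a"  (infixl \<open>\<squnion>\<index>\<close> 65)

record 'a gH = "'a hil" +
  meet :: "'a \<Rightarrow> 'a \<Rightarrow> 'a"  (infixl \<open>\<sqinter>\<index>\<close> 70)

locale hilbert_algebra =
  fixes H :: "('a, 'b) hil_scheme" (structure)
  assumes one_closed: "\<one> \<in> carrier H"
    and imp_closed: "\<lbrakk>a \<in> carrier H; b \<in> carrier H\<rbrakk> \<Longrightarrow> a \<leadsto> b \<in> carrier H"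
    and imp_K: "\<lbrakk>a \<in> carrier H; b \<in> carrier H\<rbrakk> \<Longrightarrow> a \<leadsto> (b \<leadsto> a) = \<one>"
    and imp_S: "\<lbrakk>a \<in> carrier H; b \<in> carrier H; c \<in> carrier H\<rbrakk>
      \<Longrightarrow> (a \<leadsto> (b \<leadsto> c)) \<leadsto> ((a \<leadsto> b) \<leadsto> (a \<leadsto> c)) = \<one>"
    and imp_antisym: "\<lbrakk>a \<in> carrier H; b \<in> carrier H; a \<leadsto> b = \<one>; b \<leadsto> a = \<one>\<rbrakk> \<Longrightarrow> a = b"

locale hilbert_algebra_sup = hilbert_algebra H
  for H :: "('a, 'b) hil_scheme" (structure) +
  assumes join_closed: "\<lbrakk>a \<in> carrier H; b \<in> carrier H\<rbrakk> \<Longrightarrow> a \<squnion> b \<in> carrier H"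
    and join_assoc: "\<lbrakk>a \<in> carrier H; b \<in> carrier H; c \<in> carrier H\<rbrakk>
      \<Longrightarrow> (a \<squnion> b) \<squnion> c = a \<squnion> (b \<squnion> c)"
    and join_commute: "\<lbrakk>a \<in> carrier H; b \<in> carrier H\<rbrakk> \<Longrightarrow> a \<squnion> b = b \<squnion> a"
    and join_idem: "a \<in> carrier H \<Longrightarrow> a \<squnion> a = a"
    and join_one: "a \<in> carrier H \<Longrightarrow> a \<squnion> \<one> = \<one>"
    and imp_eq_one_iff: "\<lbrakk>a \<in> carrier H; b \<in> carrier H\<rbrakk> \<Longrightarrow> a \<leadsto> b = \<one> \<longleftrightarrow> a \<squnion> b = b"

text \<open>The lattice order of a generalized Heyting algebra.\<close>

definition gH_le :: "('a, 'b) gH_scheme \<Rightarrow> 'a \<Rightarrow> 'a \<Rightarrow> bool"  (infix \<open>\<sqsubseteq>\<index>\<close> 50)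
  where "a \<sqsubseteq>\<^bsub>A\<^esub> b \<longleftrightarrow> a \<sqinter>\<^bsub>A\<^esub> b = a"

locale gH_algebra =
  fixes A :: "('a, 'b) gH_scheme" (structure)
  assumes one_closed: "\<one> \<in> carrier A"
    and meet_closed: "\<lbrakk>a \<in> carrier A; b \<in> carrier A\<rbrakk> \<Longrightarrow> a \<sqinter> b \<in> carrier A"
    and join_closed: "\<lbrakk>a \<in> carrier A; b \<in> carrier A\<rbrakk> \<Longrightarrow> a \<squnion> b \<in> carrier A"
    and imp_closed: "\<lbrakk>a \<in> carrier A; b \<in> carrier A\<rbrakk> \<Longrightarrow> a \<leadsto> b \<in> carrier A"
    and meet_assoc: "\<lbrakk>a \<in> carrier A; b \<in> carrier A; c \<in> carrier A\<rbrakk>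
      \<Longrightarrow> (a \<sqinter> b) \<sqinter> c = a \<sqinter> (b \<sqinter> c)"
    and meet_commute: "\<lbrakk>a \<in> carrier A; b \<in> carrier A\<rbrakk> \<Longrightarrow> a \<sqinter> b = b \<sqinter> a"
    and join_assoc: "\<lbrakk>a \<in> carrier A; b \<in> carrier A; c \<in> carrier A\<rbrakk>
      \<Longrightarrow> (a \<squnion> b) \<squnion> c = a \<squnion> (b \<squnion> c)"
    and join_commute: "\<lbrakk>a \<in> carrier A; b \<in> carrier A\<rbrakk> \<Longrightarrow> a \<squnion> b = b \<squnion> a"
    and meet_join_absorb: "\<lbrakk>a \<in> carrier A; b \<in> carrier A\<rbrakk> \<Longrightarrow> a \<sqinter> (a \<squnion> b) = a"
    and join_meet_absorb: "\<lbrakk>a \<in> carrier A; b \<in> carrier A\<rbrakk> \<Longrightarrow> a \<squnion> (a \<sqinter> b) = a"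
    and le_one: "a \<in> carrier A \<Longrightarrow> a \<sqsubseteq> \<one>"
    and meet_imp_le: "\<lbrakk>a \<in> carrier A; b \<in> carrier A\<rbrakk> \<Longrightarrow> a \<sqinter> (a \<leadsto> b) \<sqsubseteq> b"
    and le_impI: "\<lbrakk>a \<in> carrier A; b \<in> carrier A; c \<in> carrier A; a \<sqinter> c \<sqsubseteq> b\<rbrakk>
      \<Longrightarrow> c \<sqsubseteq> a \<leadsto> b"

text \<open>Homomorphisms are extensional functions, so that equality of arrows is equality of
  functions on the carrier.  Source and target may live over different types.\<close>

definition hil_hom :: "('a, 'm) hil_scheme \<Rightarrow> ('b, 'n) hil_scheme \<Rightarrow> ('a \<Rightarrow> 'b) set"
  where "hil_hom H G = {f \<in> carrier H \<rightarrow>\<^sub>E carrier G.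
    f \<one>\<^bsub>H\<^esub> = \<one>\<^bsub>G\<^esub> \<and>
    (\<forall>a \<in> carrier H. \<forall>b \<in> carrier H.
      f (a \<leadsto>\<^bsub>H\<^esub> b) = f a \<leadsto>\<^bsub>G\<^esub> f b \<and> f (a \<squnion>\<^bsub>H\<^esub> b) = f a \<squnion>\<^bsub>G\<^esub> f b)}"

definition gH_hom :: "('a, 'm) gH_scheme \<Rightarrow> ('b, 'n) gH_scheme \<Rightarrow> ('a \<Rightarrow> 'b) set"
  where "gH_hom A B = {f \<in> carrier A \<rightarrow>\<^sub>E carrier B.
    f \<one>\<^bsub>A\<^esub> = \<one>\<^bsub>B\<^esub> \<and>
    (\<forall>a \<in> carrier A. \<forall>b \<in> carrier A.
      f (a \<sqinter>\<^bsub>A\<^esub> b) = f a \<sqinter>\<^bsub>B\<^esub> f b \<and> f (a \<squnion>\<^bsub>A\<^esub> b) = f a \<squnion>\<^bsub>B\<^esub> f b \<and>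
      f (a \<leadsto>\<^bsub>A\<^esub> b) = f a \<leadsto>\<^bsub>B\<^esub> f b)}"

definition Hil_cat :: "('a hil, 'a \<Rightarrow> 'a) cat"
  where "Hil_cat = \<lparr>Obj = {H. hilbert_algebra_sup H}, Hom = hil_hom,
    Id = (\<lambda>H. \<lambda>x \<in> carrier H. x), Comp = (\<lambda>H _ _ g f. compose (carrier H) g f)\<rparr>"

definition gH_cat :: "('a gH, 'a \<Rightarrow> 'a) cat"
  where "gH_cat = \<lparr>Obj = {A. gH_algebra A}, Hom = gH_hom,
    Id = (\<lambda>A. \<lambda>x \<in> carrier A. x), Comp = (\<lambda>A _ _ g f. compose (carrier A) g f)\<rparr>"


section \<open>The forgetful functor\<close>

definition forget :: "'a gH \<Rightarrow> 'a hil"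
  where "forget A = \<lparr>carrier = carrier A, imp = imp A, unit_elt = unit_elt A, join = join A\<rparr>"

definition forget_map :: "'a gH \<Rightarrow> 'a gH \<Rightarrow> ('a \<Rightarrow> 'a) \<Rightarrow> ('a \<Rightarrow> 'a)"
  where "forget_map A B f = f"


section \<open>The functor given by irreducible implicative filters\<close>

definition implicative_filter :: "('a, 'm) hil_scheme \<Rightarrow> 'a set \<Rightarrow> bool"
  where "implicative_filter H F \<longleftrightarrow> F \<subseteq> carrier H \<and> \<one>\<^bsub>H\<^esub> \<in> F \<and>
    (\<forall>a \<in> carrier H. \<forall>b \<in> carrier H. a \<in> F \<and> a \<leadsto>\<^bsub>H\<^esub> b \<in> F \<longrightarrow> b \<in> F)"

definition irreducible_filter :: "('a, 'm) hil_scheme \<Rightarrow> 'a set \<Rightarrow> bool"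
  where "irreducible_filter H F \<longleftrightarrow> implicative_filter H F \<and> F \<noteq> carrier H \<and>
    (\<forall>F1 F2. implicative_filter H F1 \<and> implicative_filter H F2 \<and> F = F1 \<inter> F2
      \<longrightarrow> F = F1 \<or> F = F2)"

definition spec :: "('a, 'm) hil_scheme \<Rightarrow> 'a set set"
  where "spec H = {P. irreducible_filter H P}"

definition \<phi> :: "('a, 'm) hil_scheme \<Rightarrow> 'a \<Rightarrow> 'a set set"
  where "\<phi> H a = {P \<in> spec H. a \<in> P}"

definition spec_upset :: "('a, 'm) hil_scheme \<Rightarrow> 'a set set \<Rightarrow> bool"
  where "spec_upset H U \<longleftrightarrow> U \<subseteq> spec H \<and> (\<forall>P \<in> U. \<forall>Q \<in> spec H. P \<subseteq> Q \<longrightarrow> Q \<in> U)"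

definition spec_down :: "('a, 'm) hil_scheme \<Rightarrow> 'a set set \<Rightarrow> 'a set set"
  where "spec_down H Y = {P \<in> spec H. \<exists>Q \<in> Y. P \<subseteq> Q}"

definition upset_algebra :: "('a, 'm) hil_scheme \<Rightarrow> 'a set set gH"
  where "upset_algebra H =
    \<lparr>carrier = {U. spec_upset H U},
     imp = (\<lambda>U V. spec H - spec_down H (U \<inter> (spec H - V))),
     unit_elt = spec H,
     join = (\<union>),
     meet = (\<inter>)\<rparr>"

definition gH_subalgebra :: "('a, 'm) gH_scheme \<Rightarrow> 'a set \<Rightarrow> bool"
  where "gH_subalgebra A S \<longleftrightarrow> S \<subseteq> carrier A \<and> \<one>\<^bsub>A\<^esub> \<in> S \<and>
    (\<forall>a \<in> S. \<forall>b \<in> S. a \<sqinter>\<^bsub>A\<^esub> b \<in> S \<and> a \<squnion>\<^bsub>A\<^esub> b \<in> S \<and> a \<leadsto>\<^bsub>A\<^esub> b \<in> S)"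

definition gH_of :: "'a hil \<Rightarrow> 'a set set gH"
  where "gH_of H =
    (upset_algebra H)\<lparr>carrier := gH_subalgebra (upset_algebra H) hull (\<phi> H ` carrier H)\<rparr>"

definition R_rel :: "'a hil \<Rightarrow> 'b hil \<Rightarrow> ('a \<Rightarrow> 'b) \<Rightarrow> ('b set \<times> 'a set) set"
  where "R_rel H G f = {(P, Q). P \<in> spec G \<and> Q \<in> spec H \<and> f -` P \<inter> carrier H \<subseteq> Q}"

definition gH_of_map :: "'a hil \<Rightarrow> 'b hil \<Rightarrow> ('a \<Rightarrow> 'b) \<Rightarrow> 'a set set \<Rightarrow> 'b set set"
  where "gH_of_map H G f =
    (\<lambda>U \<in> carrier (gH_of H). {P \<in> spec G. R_rel H G f `` {P} \<subseteq> U})"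


section \<open>Adjointness\<close>

text \<open>A functor \<open>F\<close> from Hilbert algebras with supremum to generalized Heyting algebras is left
  adjoint to a functor \<open>U\<close> in the other direction if there is a bijection between the arrows
  \<open>F H \<rightarrow> A\<close> and the arrows \<open>H \<rightarrow> U A\<close>, natural in \<open>H\<close> and \<open>A\<close>.

  Because the elements of \<open>F H\<close> need not have the type of the elements of \<open>H\<close>, the two functors
  are allowed to be defined on algebras over different types \<open>'a\<close> and \<open>'b\<close>: the hom-sets are
  polymorphic in the types of the two algebras, and the arrows \<open>F H \<rightarrow> A\<close> and \<open>H \<rightarrow> U A\<close> are
  composed with arrows of the two categories as functions.  If \<open>'a\<close>, \<open>'b\<close>, \<open>'c\<close> and \<open>'d\<close>
  coincide, this is literally the usual notion of adjoint functors between \<open>Hil_cat\<close> and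
  \<open>gH_cat\<close>.\<close>

definition left_adjoint ::
  "('a hil \<Rightarrow> 'c gH) \<Rightarrow> ('a hil \<Rightarrow> 'a hil \<Rightarrow> ('a \<Rightarrow> 'a) \<Rightarrow> 'c \<Rightarrow> 'c) \<Rightarrow>
   ('b gH \<Rightarrow> 'd hil) \<Rightarrow> ('b gH \<Rightarrow> 'b gH \<Rightarrow> ('b \<Rightarrow> 'b) \<Rightarrow> 'd \<Rightarrow> 'd) \<Rightarrow> bool"
  where "left_adjoint F Fm U Um \<longleftrightarrow>
    cat_functor Hil_cat gH_cat F Fm \<and> cat_functor gH_cat Hil_cat U Um \<and>
    (\<exists>\<Phi>.
      (\<forall>H \<in> Obj Hil_cat. \<forall>A \<in> Obj gH_cat.
        bij_betw (\<Phi> H A) (gH_hom (F H) A) (hil_hom H (U A))) \<and>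
      (\<forall>H \<in> Obj Hil_cat. \<forall>H' \<in> Obj Hil_cat. \<forall>A \<in> Obj gH_cat. \<forall>A' \<in> Obj gH_cat.
        \<forall>f \<in> Hom Hil_cat H' H. \<forall>g \<in> Hom gH_cat A A'. \<forall>h \<in> gH_hom (F H) A.
          \<Phi> H' A' (compose (carrier (F H')) (compose (carrier (F H)) g h) (Fm H' H f)) =
          compose (carrier H') (compose (carrier H) (Um A A' g) (\<Phi> H A h)) f))"

end

theory Submission
  imports Defs
begin

text \<open>
  The unit of the adjunction is \<open>\<phi>\<close>, and everything rests on three facts about it.

  First, \<open>\<phi>\<close> is a homomorphism of Hilbert algebras with supremum from \<open>H\<close> into the upsets of its
  spectrum.  For the supremum this says that irreducible filters are prime; for the implication it
  needs enough irreducible filters, which a Zorn argument provides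
  (\<open>irreducible_filter_separation\<close>): a filter disjoint from a nonempty set closed under binary
  joins extends to an irreducible filter still disjoint from it.

  Secondly, for a homomorphism \<open>f\<close> from \<open>H\<close> to \<open>G\<close>, taking preimages of filters is almost a map of
  spectra in the opposite direction: the preimage of an irreducible filter is irreducible or all of
  \<open>H\<close>, and every irreducible \<open>Q\<close> above the preimage of \<open>P\<close> is itself the preimage of some
  irreducible filter above \<open>P\<close> (\<open>preimage_lifting\<close>, the back condition of a p-morphism).  Hence the
  box operator of \<open>R_rel H G f\<close> preserves not only intersections but also unions and implications,
  and because it sends \<open>\<phi> H a\<close> to \<open>\<phi> G (f a)\<close> it maps the algebra generated by \<open>\<phi>[H]\<close> into the one
  generated by \<open>\<phi>[G]\<close>.  The last equation is the naturality of the unit.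

  Thirdly, if \<open>A\<close> already is a generalized Heyting algebra, then \<open>\<phi>\<close> preserves meets as well, so its
  image is already a subalgebra and \<open>\<phi>\<close> is an isomorphism from \<open>A\<close> onto \<open>gH_of (forget A)\<close>.

  The universal property follows.  A homomorphism on \<open>gH_of H\<close> is determined by its values on the
  generators \<open>\<phi> H a\<close>; and a homomorphism \<open>h\<close> from \<open>H\<close> to \<open>forget A\<close> is the restriction along \<open>\<phi>\<close> of
  \<open>gH_of_map H (forget A) h\<close> followed by the inverse of the isomorphism for \<open>A\<close>.  So restriction
  along \<open>\<phi>\<close> is the required bijection of hom-sets.  Determination by generators also gives the
  functor laws of \<open>gH_of_map\<close> without computing with spectra.
\<close>

section \<open>Filters of Hilbert algebras\<close>

context hilbert_algebra
begin

lemma modus_ponens_one: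
  assumes "x \<in> carrier H" "\<one> \<leadsto> x = \<one>"
  shows "x = \<one>"
  using imp_K[of x \<one>] imp_antisym[of x \<one>] assms one_closed by simp

lemma imp_one: "x \<in> carrier H \<Longrightarrow> x \<leadsto> \<one> = \<one>"
  using imp_K[of \<one> x] modus_ponens_one[of "x \<leadsto> \<one>"] one_closed imp_closed by simp

lemma imp_self:
  assumes "x \<in> carrier H"
  shows "x \<leadsto> x = \<one>"
proof -
  have "\<one> \<leadsto> (\<one> \<leadsto> (x \<leadsto> x)) = \<one>"
    using imp_S[of x "x \<leadsto> x" x] imp_K[of x "x \<leadsto> x"] imp_K[of x x] assms imp_closed by simp
  then show ?thesis
    using modus_ponens_one assms imp_closed one_closed by metis
qed

lemma imp_trans:
  assumes "a \<in> carrier H" "b \<in> carrier H" "c \<in> carrier H" "a \<leadsto> b = \<one>" "b \<leadsto> c = \<one>"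
  shows "a \<leadsto> c = \<one>"
proof -
  have "\<one> \<leadsto> (\<one> \<leadsto> (a \<leadsto> c)) = \<one>"
    using imp_S[of a b c] assms imp_one[of a] by simp
  then show ?thesis
    using modus_ponens_one assms imp_closed one_closed by metis
qed

lemma imp_mono_right:
  assumes "w \<in> carrier H" "y \<in> carrier H" "z \<in> carrier H" "y \<leadsto> z = \<one>"
  shows "(w \<leadsto> y) \<leadsto> (w \<leadsto> z) = \<one>"
proof -
  have "\<one> \<leadsto> ((w \<leadsto> y) \<leadsto> (w \<leadsto> z)) = \<one>"
    using imp_S[of w y z] assms imp_one[of w] by simp
  then show ?thesis
    using modus_ponens_one assms imp_closed by metis
qed

lemma imp_exchange:
  assumes "a \<in> carrier H" "b \<in> carrier H" "c \<in> carrier H" "a \<leadsto> (b \<leadsto> c) = \<one>"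
  shows "b \<leadsto> (a \<leadsto> c) = \<one>"
proof -
  have "\<one> \<leadsto> ((a \<leadsto> b) \<leadsto> (a \<leadsto> c)) = \<one>"
    using imp_S[of a b c] assms by simp
  then have "(a \<leadsto> b) \<leadsto> (a \<leadsto> c) = \<one>"
    using modus_ponens_one assms imp_closed by metis
  then show ?thesis
    using imp_trans[of b "a \<leadsto> b" "a \<leadsto> c"] imp_K[of b a] assms imp_closed by simp
qed

lemma imp_imp_self:
  assumes "a \<in> carrier H" "x \<in> carrier H"
  shows "a \<leadsto> ((a \<leadsto> x) \<leadsto> x) = \<one>"
  using imp_exchange[of "a \<leadsto> x" a x] imp_self[of "a \<leadsto> x"] assms imp_closed by simp

lemma filter_one: "implicative_filter H F \<Longrightarrow> \<one> \<in> F"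
  by (simp add: implicative_filter_def)

lemma filter_mem: "implicative_filter H F \<Longrightarrow> x \<in> F \<Longrightarrow> x \<in> carrier H"
  by (auto simp: implicative_filter_def)

lemma filter_mp:
  "implicative_filter H F \<Longrightarrow> a \<in> F \<Longrightarrow> a \<leadsto> b \<in> F \<Longrightarrow> b \<in> carrier H \<Longrightarrow> b \<in> F"
  by (auto simp: implicative_filter_def)

lemma filter_up:
  "implicative_filter H F \<Longrightarrow> a \<in> F \<Longrightarrow> a \<leadsto> b = \<one> \<Longrightarrow> b \<in> carrier H \<Longrightarrow> b \<in> F"
  using filter_mp filter_one by metis

text \<open>By the deduction theorem, \<open>{x. a \<leadsto> x \<in> F}\<close> is the filter generated by \<open>F\<close> and \<open>a\<close>.  Adding one
  element at a time in this way avoids finite iterations of the implication altogether.\<close>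

lemma filter_adjoin:
  assumes F: "implicative_filter H F" and a: "a \<in> carrier H"
  shows "implicative_filter H {x \<in> carrier H. a \<leadsto> x \<in> F}"
  unfolding implicative_filter_def
proof (intro conjI ballI impI)
  show "\<one> \<in> {x \<in> carrier H. a \<leadsto> x \<in> F}"
    using imp_one[OF a] filter_one[OF F] one_closed by simp
next
  fix x y assume xy: "x \<in> carrier H" "y \<in> carrier H"
    and prem: "x \<in> {x \<in> carrier H. a \<leadsto> x \<in> F} \<and> x \<leadsto> y \<in> {x \<in> carrier H. a \<leadsto> x \<in> F}"
  have "(a \<leadsto> x) \<leadsto> (a \<leadsto> y) \<in> F"
    by (rule filter_up[OF F, of "a \<leadsto> (x \<leadsto> y)"]) (use prem xy a imp_S imp_closed in auto)
  then have "a \<leadsto> y \<in> F"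
    using filter_mp[OF F, of "a \<leadsto> x"] prem xy a imp_closed by auto
  then show "y \<in> {x \<in> carrier H. a \<leadsto> x \<in> F}" using xy by simp
qed auto

lemma filter_adjoin_superset:
  assumes F: "implicative_filter H F" and a: "a \<in> carrier H"
  shows "F \<subseteq> {x \<in> carrier H. a \<leadsto> x \<in> F}" "a \<in> {x \<in> carrier H. a \<leadsto> x \<in> F}"
proof -
  show "F \<subseteq> {x \<in> carrier H. a \<leadsto> x \<in> F}"
    using filter_mem[OF F] filter_up[OF F] imp_K a imp_closed by fastforce
  show "a \<in> {x \<in> carrier H. a \<leadsto> x \<in> F}"
    using imp_self[OF a] filter_one[OF F] a by simp
qed

lemma filter_singleton_one: "implicative_filter H {\<one>}"
  using modus_ponens_one by (auto simp: implicative_filter_def one_closed)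

lemma filter_Union_chain:
  assumes "C \<noteq> {}" "\<And>F. F \<in> C \<Longrightarrow> implicative_filter H F"
    "\<And>F F'. F \<in> C \<Longrightarrow> F' \<in> C \<Longrightarrow> F \<subseteq> F' \<or> F' \<subseteq> F"
  shows "implicative_filter H (\<Union>C)"
  unfolding implicative_filter_def
proof (intro conjI ballI impI)
  fix a b assume ab: "a \<in> carrier H" "b \<in> carrier H" "a \<in> \<Union>C \<and> a \<leadsto> b \<in> \<Union>C"
  then obtain F F' where F: "F \<in> C" "F' \<in> C" "a \<in> F" "a \<leadsto> b \<in> F'" by auto
  then have "b \<in> F \<or> b \<in> F'"
    using assms(3)[OF F(1,2)] filter_mp assms(2) ab by (metis subsetD)
  then show "b \<in> \<Union>C" using F by auto
qed (use assms filter_one filter_mem in blast)+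

lemma spec_filter: "P \<in> spec H \<Longrightarrow> implicative_filter H P"
  and spec_proper: "P \<in> spec H \<Longrightarrow> P \<noteq> carrier H"
  by (auto simp: spec_def irreducible_filter_def)

end

section \<open>Irreducible filters in the presence of suprema\<close>

context hilbert_algebra_sup
begin

lemma le_join_left: "a \<in> carrier H \<Longrightarrow> b \<in> carrier H \<Longrightarrow> a \<leadsto> (a \<squnion> b) = \<one>"
  using imp_eq_one_iff[of a "a \<squnion> b"] join_assoc[of a a b] join_idem join_closed by simp

lemma le_join_right: "a \<in> carrier H \<Longrightarrow> b \<in> carrier H \<Longrightarrow> b \<leadsto> (a \<squnion> b) = \<one>"
  using le_join_left[of b a] join_commute by simp

lemma join_least:
  "a \<in> carrier H \<Longrightarrow> b \<in> carrier H \<Longrightarrow> c \<in> carrier H \<Longrightarrow> a \<leadsto> c = \<one> \<Longrightarrow> b \<leadsto> c = \<one>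
    \<Longrightarrow> (a \<squnion> b) \<leadsto> c = \<one>"
  using imp_eq_one_iff join_assoc join_closed by simp

text \<open>Proof by cases inside a filter: its elements include the join of \<open>a\<close> and \<open>b\<close> and both
  implications.  The join lies below \<open>(b \<leadsto> x) \<leadsto> ((a \<leadsto> x) \<leadsto> x)\<close>, because \<open>a\<close> and \<open>b\<close> do, so two
  applications of modus ponens give \<open>x\<close>.\<close>

lemma filter_join_elim:
  assumes F: "implicative_filter H F"
    and ab: "a \<in> carrier H" "b \<in> carrier H" "x \<in> carrier H"
    and mem: "a \<squnion> b \<in> F" "a \<leadsto> x \<in> F" "b \<leadsto> x \<in> F"
  shows "x \<in> F"
proof -
  let ?d = "(a \<leadsto> x) \<leadsto> x" and ?c = "(b \<leadsto> x) \<leadsto> ((a \<leadsto> x) \<leadsto> x)"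
  note cl = ab imp_closed
  have "a \<leadsto> ?c = \<one>"
    using imp_trans[of a ?d ?c] imp_imp_self[of a x] imp_K[of ?d "b \<leadsto> x"] cl by simp
  moreover have "b \<leadsto> ?c = \<one>"
    using imp_trans[of b "(b \<leadsto> x) \<leadsto> x" ?c] imp_imp_self[of b x]
      imp_mono_right[of "b \<leadsto> x" x ?d] imp_K[of x "a \<leadsto> x"] cl by simp
  ultimately have "(a \<squnion> b) \<leadsto> ?c = \<one>" using join_least cl by simp
  then have "?c \<in> F" using filter_up[OF F mem(1)] cl by simp
  then have "?d \<in> F" using filter_mp[OF F mem(3)] cl by simp
  then show ?thesis using filter_mp[OF F mem(2)] cl by simp
qed

text \<open>If neither \<open>a\<close> nor \<open>b\<close> belonged to \<open>P\<close> although their join does, adjoining either of them would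
  give two larger filters which, by the preceding lemma, meet in \<open>P\<close>.\<close>

lemma spec_prime:
  assumes P: "P \<in> spec H" and ab: "a \<in> carrier H" "b \<in> carrier H"
    and mem: "a \<squnion> b \<in> P"
  shows "a \<in> P \<or> b \<in> P"
proof -
  let ?A = "{x \<in> carrier H. a \<leadsto> x \<in> P}" and ?B = "{x \<in> carrier H. b \<leadsto> x \<in> P}"
  note Pf = spec_filter[OF P]
  have "P = ?A \<inter> ?B"
    using filter_adjoin_superset(1)[OF Pf] ab filter_join_elim[OF Pf ab _ mem] by blast
  then have "P = ?A \<or> P = ?B"
    using P filter_adjoin[OF Pf] ab unfolding spec_def irreducible_filter_def by blast
  then show ?thesis
    using filter_adjoin_superset(2)[OF Pf] ab by blast
qed

lemma spec_join_iff:
  assumes "P \<in> spec H" "a \<in> carrier H" "b \<in> carrier H"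
  shows "a \<squnion> b \<in> P \<longleftrightarrow> a \<in> P \<or> b \<in> P"
  using assms spec_prime filter_up[OF spec_filter[OF assms(1)]] le_join_left le_join_right
    join_closed by meson

text \<open>Conversely, elements \<open>a\<close> and \<open>b\<close> witnessing that two filters properly extend \<open>P\<close> have their join in
  the intersection of the two.\<close>

lemma spec_of_prime:
  assumes P: "implicative_filter H P" "P \<noteq> carrier H"
    and prime: "\<And>a b. a \<in> carrier H \<Longrightarrow> b \<in> carrier H \<Longrightarrow> a \<squnion> b \<in> P \<Longrightarrow> a \<in> P \<or> b \<in> P"
  shows "P \<in> spec H"
proof -
  have "P = F1 \<or> P = F2"
    if F: "implicative_filter H F1" "implicative_filter H F2" "P = F1 \<inter> F2" for F1 F2
  proof (rule ccontr)
    assume "\<not> ?thesis"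
    then obtain a b where ab: "a \<in> F1" "a \<notin> P" "b \<in> F2" "b \<notin> P" using F by blast
    have cl: "a \<in> carrier H" "b \<in> carrier H" using ab F filter_mem by auto
    have "a \<squnion> b \<in> P"
      using F(3) filter_up[OF F(1) ab(1)] filter_up[OF F(2) ab(3)] le_join_left le_join_right
        join_closed cl by simp
    then show False using prime cl ab by blast
  qed
  then show ?thesis using P by (simp add: spec_def irreducible_filter_def)
qed

text \<open>A filter \<open>P\<close> maximal among those containing \<open>F\<close> and disjoint from \<open>I\<close> is prime.  If \<open>a \<squnion> b\<close>
  belonged to \<open>P\<close> but neither \<open>a\<close> nor \<open>b\<close> did, adjoining them would produce \<open>x\<close> and \<open>y\<close> in \<open>I\<close> with
  \<open>a \<leadsto> x\<close> and \<open>b \<leadsto> y\<close> in \<open>P\<close>, and proof by cases would put \<open>x \<squnion> y\<close> into both \<open>P\<close> and \<open>I\<close>.  The last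
  conjunct retains the maximality, which the lifting of filters along homomorphisms needs.\<close>

lemma irreducible_filter_separation:
  assumes F: "implicative_filter H F" and I: "I \<subseteq> carrier H" "I \<noteq> {}" "F \<inter> I = {}"
    and I_join: "\<And>a b. a \<in> I \<Longrightarrow> b \<in> I \<Longrightarrow> a \<squnion> b \<in> I"
  shows "\<exists>P \<in> spec H. F \<subseteq> P \<and> P \<inter> I = {} \<and>
    (\<forall>a \<in> carrier H - P. \<exists>x \<in> I. a \<leadsto> x \<in> P)"
proof -
  let ?S = "{P. implicative_filter H P \<and> F \<subseteq> P \<and> P \<inter> I = {}}"
  have "\<exists>M \<in> ?S. \<forall>X \<in> ?S. M \<subseteq> X \<longrightarrow> X = M"
  proof (rule subset_Zorn_nonempty)
    show "?S \<noteq> {}" using F I by auto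
  next
    fix C assume C: "C \<noteq> {}" "subset.chain ?S C"
    have "implicative_filter H (\<Union>C)"
      by (rule filter_Union_chain) (use C in \<open>auto simp: subset_chain_def\<close>)
    then show "\<Union>C \<in> ?S" using C by (auto simp: subset_chain_def)
  qed
  then obtain P where P: "P \<in> ?S" and P_max: "\<forall>X \<in> ?S. P \<subseteq> X \<longrightarrow> X = P" ..
  from P have P: "implicative_filter H P" "F \<subseteq> P" "P \<inter> I = {}" by simp_all
  have grow: "\<exists>x \<in> I. a \<leadsto> x \<in> P" if a: "a \<in> carrier H" "a \<notin> P" for a
  proof (rule ccontr)
    let ?X = "{x \<in> carrier H. a \<leadsto> x \<in> P}"
    assume "\<not> ?thesis"
    then have "?X \<in> ?S"
      using filter_adjoin[OF P(1) a(1)] filter_adjoin_superset(1)[OF P(1) a(1)] P(2) by blast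
    then have "?X = P"
      using P_max filter_adjoin_superset(1)[OF P(1) a(1)] by blast
    then show False using filter_adjoin_superset(2)[OF P(1) a(1)] a(2) by simp
  qed
  have "P \<in> spec H"
  proof (rule spec_of_prime[OF P(1)])
    show "P \<noteq> carrier H" using P I by auto
  next
    fix a b assume ab: "a \<in> carrier H" "b \<in> carrier H" "a \<squnion> b \<in> P"
    show "a \<in> P \<or> b \<in> P"
    proof (rule ccontr)
      assume "\<not> ?thesis"
      then obtain x y where xy: "x \<in> I" "y \<in> I" "a \<leadsto> x \<in> P" "b \<leadsto> y \<in> P"
        using grow ab by metis
      have cl: "x \<in> carrier H" "y \<in> carrier H" using xy I by auto
      have "(a \<leadsto> x) \<leadsto> (a \<leadsto> (x \<squnion> y)) = \<one>" "(b \<leadsto> y) \<leadsto> (b \<leadsto> (x \<squnion> y)) = \<one>"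
        using imp_mono_right le_join_left le_join_right join_closed cl ab by simp_all
      then have "a \<leadsto> (x \<squnion> y) \<in> P" "b \<leadsto> (x \<squnion> y) \<in> P"
        using filter_up[OF P(1) xy(3)] filter_up[OF P(1) xy(4)] cl ab imp_closed join_closed
        by simp_all
      then have "x \<squnion> y \<in> P"
        by (rule filter_join_elim[OF P(1) ab(1,2) join_closed[OF cl] ab(3)])
      then have "x \<squnion> y \<in> P \<inter> I" using I_join[OF xy(1,2)] by (rule IntI)
      then show False unfolding P(3) by (rule emptyE)
    qed
  qed
  then show ?thesis
    by (rule bexI[rotated]) (intro conjI P ballI; elim DiffE; rule grow)
qed

lemma filter_separation_point:
  assumes "implicative_filter H F" "b \<in> carrier H" "b \<notin> F"
  shows "\<exists>P \<in> spec H. F \<subseteq> P \<and> b \<notin> P"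
proof -
  have "\<exists>P \<in> spec H. F \<subseteq> P \<and> P \<inter> {b} = {} \<and> (\<forall>a \<in> carrier H - P. \<exists>x \<in> {b}. a \<leadsto> x \<in> P)"
    by (rule irreducible_filter_separation) (use assms join_idem in simp_all)
  then show ?thesis by blast
qed

text \<open>This is the truth lemma for the Kripke frame of irreducible filters.\<close>

lemma spec_imp_iff:
  assumes P: "P \<in> spec H" and ab: "a \<in> carrier H" "b \<in> carrier H"
  shows "a \<leadsto> b \<in> P \<longleftrightarrow> (\<forall>Q \<in> spec H. P \<subseteq> Q \<and> a \<in> Q \<longrightarrow> b \<in> Q)"
proof
  assume "a \<leadsto> b \<in> P"
  then show "\<forall>Q \<in> spec H. P \<subseteq> Q \<and> a \<in> Q \<longrightarrow> b \<in> Q"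
    using filter_mp spec_filter ab by blast
next
  assume *: "\<forall>Q \<in> spec H. P \<subseteq> Q \<and> a \<in> Q \<longrightarrow> b \<in> Q"
  note Pf = spec_filter[OF P]
  show "a \<leadsto> b \<in> P"
  proof (rule ccontr)
    assume "a \<leadsto> b \<notin> P"
    then obtain Q where "Q \<in> spec H" "{x \<in> carrier H. a \<leadsto> x \<in> P} \<subseteq> Q" "b \<notin> Q"
      using filter_separation_point[OF filter_adjoin[OF Pf ab(1)] ab(2)] by auto
    then show False using * filter_adjoin_superset[OF Pf ab(1)] by blast
  qed
qed

end

section \<open>Upsets of the spectrum\<close>

lemma gH_hom_simps:
  assumes "f \<in> gH_hom A B"
  shows "f \<one>\<^bsub>A\<^esub> = \<one>\<^bsub>B\<^esub>"
    and "a \<in> carrier A \<Longrightarrow> b \<in> carrier A \<Longrightarrow> f (a \<sqinter>\<^bsub>A\<^esub> b) = f a \<sqinter>\<^bsub>B\<^esub> f b"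
    and "a \<in> carrier A \<Longrightarrow> b \<in> carrier A \<Longrightarrow> f (a \<squnion>\<^bsub>A\<^esub> b) = f a \<squnion>\<^bsub>B\<^esub> f b"
    and "a \<in> carrier A \<Longrightarrow> b \<in> carrier A \<Longrightarrow> f (a \<leadsto>\<^bsub>A\<^esub> b) = f a \<leadsto>\<^bsub>B\<^esub> f b"
    and "a \<in> carrier A \<Longrightarrow> f a \<in> carrier B"
    and "f \<in> extensional (carrier A)"
  using assms by (auto simp: gH_hom_def PiE_def)

lemma hil_hom_simps:
  assumes "f \<in> hil_hom A B"
  shows "f \<one>\<^bsub>A\<^esub> = \<one>\<^bsub>B\<^esub>"
    and "a \<in> carrier A \<Longrightarrow> b \<in> carrier A \<Longrightarrow> f (a \<squnion>\<^bsub>A\<^esub> b) = f a \<squnion>\<^bsub>B\<^esub> f b"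
    and "a \<in> carrier A \<Longrightarrow> b \<in> carrier A \<Longrightarrow> f (a \<leadsto>\<^bsub>A\<^esub> b) = f a \<leadsto>\<^bsub>B\<^esub> f b"
    and "a \<in> carrier A \<Longrightarrow> f a \<in> carrier B"
    and "f \<in> extensional (carrier A)"
  using assms by (auto simp: hil_hom_def PiE_def)

lemma upset_algebra_simps [simp]:
  "carrier (upset_algebra H) = {U. spec_upset H U}"
  "\<one>\<^bsub>upset_algebra H\<^esub> = spec H"
  "U \<squnion>\<^bsub>upset_algebra H\<^esub> V = U \<union> V"
  "U \<sqinter>\<^bsub>upset_algebra H\<^esub> V = U \<inter> V"
  by (simp_all add: upset_algebra_def)

lemma upset_imp:
  "U \<leadsto>\<^bsub>upset_algebra H\<^esub> V = {P \<in> spec H. \<forall>Q \<in> spec H. P \<subseteq> Q \<and> Q \<in> U \<longrightarrow> Q \<in> V}"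
  by (auto simp: upset_algebra_def spec_down_def)

lemma gH_algebra_upset: "gH_algebra (upset_algebra H)"
proof
  fix U V assume UV: "U \<in> carrier (upset_algebra H)" "V \<in> carrier (upset_algebra H)"
  show "U \<leadsto>\<^bsub>upset_algebra H\<^esub> V \<in> carrier (upset_algebra H)"
    by (auto simp: spec_upset_def upset_imp)
  show "U \<sqinter>\<^bsub>upset_algebra H\<^esub> (U \<leadsto>\<^bsub>upset_algebra H\<^esub> V) \<sqsubseteq>\<^bsub>upset_algebra H\<^esub> V"
    using UV by (auto simp: gH_le_def upset_imp)
next
  fix U V W assume UVW: "U \<in> carrier (upset_algebra H)" "V \<in> carrier (upset_algebra H)"
    "W \<in> carrier (upset_algebra H)" and le: "U \<sqinter>\<^bsub>upset_algebra H\<^esub> W \<sqsubseteq>\<^bsub>upset_algebra H\<^esub> V"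
  have "Q \<in> V" if "P \<in> W" "Q \<in> spec H" "P \<subseteq> Q" "Q \<in> U" for P Q
    using that UVW(3) le unfolding gH_le_def spec_upset_def upset_algebra_simps by blast
  then show "W \<sqsubseteq>\<^bsub>upset_algebra H\<^esub> (U \<leadsto>\<^bsub>upset_algebra H\<^esub> V)"
    using UVW(3) by (auto simp: gH_le_def upset_imp spec_upset_def)
qed (auto simp: gH_le_def spec_upset_def)

lemma gH_subalgebra_algebra:
  assumes "gH_algebra A" "gH_subalgebra A S"
  shows "gH_algebra (A\<lparr>carrier := S\<rparr>)"
proof -
  interpret gH_algebra A by fact
  have S: "x \<in> S \<Longrightarrow> x \<in> carrier A" for x using assms(2) by (auto simp: gH_subalgebra_def)
  show ?thesis
    by unfold_locales
      ((use assms(2) in \<open>simp_all add: gH_subalgebra_def gH_le_def\<close>),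
       (blast intro: S meet_assoc join_assoc meet_commute join_commute meet_join_absorb
         join_meet_absorb le_one[unfolded gH_le_def] meet_imp_le[unfolded gH_le_def]
         le_impI[unfolded gH_le_def])+)
qed

lemma gH_subalgebra_carrier:
  assumes "gH_algebra A"
  shows "gH_subalgebra A (carrier A)"
proof -
  interpret gH_algebra A by fact
  show ?thesis
    by (simp add: gH_subalgebra_def one_closed meet_closed join_closed imp_closed)
qed

text \<open>The empty intersection \<open>UNIV\<close> is a subalgebra only if it is the carrier, so the general
  fact about hulls of intersection-closed families does not apply; the inclusion of the generators
  in the carrier is what makes the family nonempty.\<close>

lemma gH_subalgebra_hull:
  assumes "gH_algebra A" "B \<subseteq> carrier A"
  shows "gH_subalgebra A (gH_subalgebra A hull B)"
  using gH_subalgebra_carrier[OF assms(1)] assms(2)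
  unfolding hull_def gH_subalgebra_def by blast

lemma \<phi>_upset: "spec_upset H (\<phi> H a)"
  by (auto simp: spec_upset_def \<phi>_def)

lemma gH_of_simps [simp]:
  "\<one>\<^bsub>gH_of H\<^esub> = spec H"
  "U \<squnion>\<^bsub>gH_of H\<^esub> V = U \<union> V"
  "U \<sqinter>\<^bsub>gH_of H\<^esub> V = U \<inter> V"
  "U \<leadsto>\<^bsub>gH_of H\<^esub> V = U \<leadsto>\<^bsub>upset_algebra H\<^esub> V"
  by (simp_all add: gH_of_def)

lemma carrier_gH_of:
  "carrier (gH_of H) = gH_subalgebra (upset_algebra H) hull (\<phi> H ` carrier H)"
  by (simp add: gH_of_def)

lemma gH_subalgebra_gH_of: "gH_subalgebra (upset_algebra H) (carrier (gH_of H))"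
  unfolding carrier_gH_of
  by (rule gH_subalgebra_hull[OF gH_algebra_upset]) (auto simp: \<phi>_upset)

lemma gH_algebra_gH_of: "gH_algebra (gH_of H)"
  using gH_subalgebra_algebra[OF gH_algebra_upset gH_subalgebra_gH_of[of H]]
  by (simp add: gH_of_def)

lemma \<phi>_in_gH_of: "a \<in> carrier H \<Longrightarrow> \<phi> H a \<in> carrier (gH_of H)"
  unfolding carrier_gH_of by (rule hull_inc) simp

lemma gH_of_upset: "U \<in> carrier (gH_of H) \<Longrightarrow> spec_upset H U"
  using gH_subalgebra_gH_of[of H] by (auto simp: gH_subalgebra_def)

lemma gH_of_induct:
  assumes "gH_subalgebra (upset_algebra H) S" "\<And>a. a \<in> carrier H \<Longrightarrow> \<phi> H a \<in> S"
  shows "carrier (gH_of H) \<subseteq> S"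
  unfolding carrier_gH_of by (rule hull_minimal) (use assms in auto)

text \<open>The equalizer of two homomorphisms is a subalgebra.\<close>

lemma gH_hom_eqI:
  assumes f: "f \<in> gH_hom (gH_of H) A" and g: "g \<in> gH_hom (gH_of H) A"
    and eq: "\<And>a. a \<in> carrier H \<Longrightarrow> f (\<phi> H a) = g (\<phi> H a)"
  shows "f = g"
proof -
  have "carrier (gH_of H) \<subseteq> {U \<in> carrier (gH_of H). f U = g U}"
  proof (rule gH_of_induct)
    show "gH_subalgebra (upset_algebra H) {U \<in> carrier (gH_of H). f U = g U}"
      using gH_subalgebra_gH_of[of H] gH_hom_simps[OF f] gH_hom_simps[OF g]
      by (auto simp: gH_subalgebra_def)
  qed (simp add: \<phi>_in_gH_of eq)
  then show ?thesis
    by (intro extensionalityI[OF gH_hom_simps(6)[OF f] gH_hom_simps(6)[OF g]]) auto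
qed

section \<open>The unit\<close>

context hilbert_algebra_sup
begin

lemma \<phi>_one: "\<phi> H \<one> = spec H"
  using spec_filter filter_one by (auto simp: \<phi>_def)

lemma \<phi>_join: "a \<in> carrier H \<Longrightarrow> b \<in> carrier H \<Longrightarrow> \<phi> H (a \<squnion> b) = \<phi> H a \<union> \<phi> H b"
  using spec_join_iff by (auto simp: \<phi>_def)

lemma \<phi>_imp:
  "a \<in> carrier H \<Longrightarrow> b \<in> carrier H \<Longrightarrow> \<phi> H (a \<leadsto> b) = \<phi> H a \<leadsto>\<^bsub>upset_algebra H\<^esub> \<phi> H b"
  unfolding upset_imp using spec_imp_iff by (auto simp: \<phi>_def)

text \<open>If \<open>a \<leadsto> b\<close> is not the top, some irreducible filter omits it, and above that one there is another
  containing \<open>a\<close> but not \<open>b\<close>.  So \<open>\<phi>\<close> even reflects the order.\<close>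

lemma inj_\<phi>: "inj_on (\<phi> H) (carrier H)"
proof -
  have le: "a \<leadsto> b = \<one>"
    if ab: "a \<in> carrier H" "b \<in> carrier H" "\<phi> H a = \<phi> H b" for a b
  proof (rule ccontr)
    assume "a \<leadsto> b \<noteq> \<one>"
    then obtain P where P: "P \<in> spec H" "a \<leadsto> b \<notin> P"
      using filter_separation_point[OF filter_singleton_one, of "a \<leadsto> b"] ab imp_closed by auto
    then obtain Q where "Q \<in> spec H" "a \<in> Q" "b \<notin> Q" using spec_imp_iff ab by blast
    then show False using ab by (auto simp: \<phi>_def)
  qed
  show ?thesis
    by (rule inj_onI) (use le imp_antisym in metis)
qed

end

section \<open>The action on homomorphisms\<close>

text \<open>The box operator of \<open>R_rel H G f\<close>, defined on all sets of irreducible filters.  On the whole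
  algebra of upsets its homomorphism property can be shown before one knows that the generated
  subalgebras are respected.\<close>

definition box :: "'a hil \<Rightarrow> 'b hil \<Rightarrow> ('a \<Rightarrow> 'b) \<Rightarrow> 'a set set \<Rightarrow> 'b set set"
  where "box H G f U = {P \<in> spec G. \<forall>Q \<in> spec H. f -` P \<inter> carrier H \<subseteq> Q \<longrightarrow> Q \<in> U}"

lemma gH_of_map_eq: "gH_of_map H G f = restrict (box H G f) (carrier (gH_of H))"
  by (auto simp: gH_of_map_def box_def R_rel_def restrict_def fun_eq_iff)

locale hil_morphism =
  H: hilbert_algebra_sup H + G: hilbert_algebra_sup G
  for H :: "'a hil" and G :: "'b hil" +
  fixes f :: "'a \<Rightarrow> 'b"
  assumes hom: "f \<in> hil_hom H G"
begin

lemmas f_simps = hil_hom_simps[OF hom]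

lemma preimage_filter:
  assumes P: "implicative_filter G P"
  shows "implicative_filter H (f -` P \<inter> carrier H)"
  unfolding implicative_filter_def
proof (intro conjI ballI impI)
  show "\<one>\<^bsub>H\<^esub> \<in> f -` P \<inter> carrier H"
    using f_simps(1) H.one_closed G.filter_one[OF P] by simp
next
  fix a b assume ab: "a \<in> carrier H" "b \<in> carrier H"
    and "a \<in> f -` P \<inter> carrier H \<and> a \<leadsto>\<^bsub>H\<^esub> b \<in> f -` P \<inter> carrier H"
  then have "f a \<in> P" "f a \<leadsto>\<^bsub>G\<^esub> f b \<in> P" using f_simps(3)[OF ab] by simp_all
  then have "f b \<in> P" using f_simps(4)[OF ab(2)] by (rule G.filter_mp[OF P])
  then show "b \<in> f -` P \<inter> carrier H" using ab(2) by simp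
qed simp

lemma preimage_spec:
  assumes P: "P \<in> spec G" and ne: "f -` P \<inter> carrier H \<noteq> carrier H"
  shows "f -` P \<inter> carrier H \<in> spec H"
  by (rule H.spec_of_prime[OF preimage_filter[OF G.spec_filter[OF P]] ne])
    (use G.spec_prime[OF P] f_simps in auto)

text \<open>Take \<open>P'\<close> maximal among the filters above \<open>P\<close> that avoid \<open>f[H - Q]\<close>; this set is closed under
  joins because \<open>Q\<close> is prime.  If some \<open>q\<close> in \<open>Q\<close> had \<open>f q\<close> outside \<open>P'\<close>, adjoining \<open>f q\<close> would produce
  \<open>f r\<close> with \<open>r\<close> outside \<open>Q\<close>, so \<open>f (q \<leadsto> r)\<close> would lie in \<open>P'\<close>; as \<open>P'\<close> avoids \<open>f[H - Q]\<close>, this puts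
  \<open>q \<leadsto> r\<close> and hence \<open>r\<close> into \<open>Q\<close>.\<close>

lemma preimage_lifting:
  assumes P: "P \<in> spec G" and Q: "Q \<in> spec H" and sub: "f -` P \<inter> carrier H \<subseteq> Q"
  shows "\<exists>P' \<in> spec G. P \<subseteq> P' \<and> f -` P' \<inter> carrier H = Q"
proof -
  note Qf = H.spec_filter[OF Q]
  have "\<exists>P' \<in> spec G. P \<subseteq> P' \<and> P' \<inter> f ` (carrier H - Q) = {} \<and>
      (\<forall>a \<in> carrier G - P'. \<exists>x \<in> f ` (carrier H - Q). a \<leadsto>\<^bsub>G\<^esub> x \<in> P')"
  proof (rule G.irreducible_filter_separation[OF G.spec_filter[OF P]])
    show "f ` (carrier H - Q) \<noteq> {}"
      using H.spec_proper[OF Q] H.filter_mem[OF Qf] by blast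
  next
    fix x y assume "x \<in> f ` (carrier H - Q)" "y \<in> f ` (carrier H - Q)"
    then obtain a b where ab: "a \<in> carrier H - Q" "x = f a" "b \<in> carrier H - Q" "y = f b"
      by auto
    then have "a \<squnion>\<^bsub>H\<^esub> b \<in> carrier H - Q"
      using H.spec_prime[OF Q] H.join_closed by auto
    then show "x \<squnion>\<^bsub>G\<^esub> y \<in> f ` (carrier H - Q)"
      using ab f_simps(2)[of a b] by (metis DiffD1 imageI)
  qed (use sub f_simps in auto)
  then obtain P' where P': "P' \<in> spec G" "P \<subseteq> P'" "P' \<inter> f ` (carrier H - Q) = {}"
    and max: "\<And>a. a \<in> carrier G - P' \<Longrightarrow> \<exists>r \<in> carrier H - Q. a \<leadsto>\<^bsub>G\<^esub> f r \<in> P'"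
    by fast
  have "f q \<in> P'" if q: "q \<in> Q" for q
  proof (rule ccontr)
    assume no: "f q \<notin> P'"
    have qH: "q \<in> carrier H" using q H.filter_mem[OF Qf] by blast
    then obtain r where r: "r \<in> carrier H" "r \<notin> Q" "f q \<leadsto>\<^bsub>G\<^esub> f r \<in> P'"
      using max[of "f q"] no f_simps by auto
    then have "f (q \<leadsto>\<^bsub>H\<^esub> r) \<in> P'" using f_simps qH by simp
    then have "q \<leadsto>\<^bsub>H\<^esub> r \<in> Q" using P'(3) H.imp_closed[OF qH r(1)] by blast
    then show False using H.filter_mp[OF Qf q] r by blast
  qed
  then have "f -` P' \<inter> carrier H = Q"
    using P'(3) H.filter_mem[OF Qf] by blast
  then show ?thesis using P' by blast
qed

text \<open>A filter is the intersection of the irreducible filters above it, so \<open>a\<close> lies in all irreducible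
  filters above the preimage of \<open>P\<close> exactly if it lies in that preimage.\<close>

lemma box_\<phi>:
  assumes a: "a \<in> carrier H"
  shows "box H G f (\<phi> H a) = \<phi> G (f a)"
proof -
  have "(\<forall>Q \<in> spec H. f -` P \<inter> carrier H \<subseteq> Q \<longrightarrow> a \<in> Q) \<longleftrightarrow> f a \<in> P" if "P \<in> spec G" for P
    using H.filter_separation_point[OF preimage_filter[OF G.spec_filter[OF that]] a] a by blast
  then show ?thesis by (auto simp: box_def \<phi>_def)
qed

lemma box_one: "box H G f (spec H) = spec G"
  by (auto simp: box_def)

lemma box_Int: "box H G f (U \<inter> V) = box H G f U \<inter> box H G f V"
  by (auto simp: box_def)

text \<open>The relation sees either nothing or a principal upset, and a principal upset contained in
  \<open>U \<union> V\<close> is contained in \<open>U\<close> or in \<open>V\<close>.\<close>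

lemma box_Un:
  assumes U: "spec_upset H U" and V: "spec_upset H V"
  shows "box H G f (U \<union> V) = box H G f U \<union> box H G f V"
proof
  show "box H G f (U \<union> V) \<subseteq> box H G f U \<union> box H G f V"
  proof
    fix P assume P: "P \<in> box H G f (U \<union> V)"
    let ?Q = "f -` P \<inter> carrier H"
    have Ps: "P \<in> spec G" using P by (simp add: box_def)
    show "P \<in> box H G f U \<union> box H G f V"
    proof (cases "?Q = carrier H")
      case True
      have "\<not> ?Q \<subseteq> Q" if "Q \<in> spec H" for Q
        unfolding True using that H.spec_proper H.spec_filter H.filter_mem by blast
      then show ?thesis using Ps by (auto simp: box_def)
    next
      case False
      then have "?Q \<in> spec H" using preimage_spec Ps by blast
      then have "?Q \<in> U \<or> ?Q \<in> V" using P by (auto simp: box_def)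
      then show ?thesis
        using U V Ps unfolding box_def spec_upset_def by blast
    qed
  qed
qed (auto simp: box_def)

lemma box_imp:
  assumes U: "spec_upset H U"
  shows "box H G f (U \<leadsto>\<^bsub>upset_algebra H\<^esub> V)
    = box H G f U \<leadsto>\<^bsub>upset_algebra G\<^esub> box H G f V"
proof
  show "box H G f (U \<leadsto>\<^bsub>upset_algebra H\<^esub> V) \<subseteq> box H G f U \<leadsto>\<^bsub>upset_algebra G\<^esub> box H G f V"
  proof
    fix P assume P: "P \<in> box H G f (U \<leadsto>\<^bsub>upset_algebra H\<^esub> V)"
    have PV: "Q \<in> V" if "Q \<in> spec H" "f -` P \<inter> carrier H \<subseteq> Q" "Q \<in> U" for Q
      using P that by (auto simp: box_def upset_imp)
    have "P' \<in> box H G f V" if P': "P' \<in> spec G" "P \<subseteq> P'" "P' \<in> box H G f U" for P'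
    proof -
      have "Q \<in> V" if Q: "Q \<in> spec H" "f -` P' \<inter> carrier H \<subseteq> Q" for Q
        by (rule PV[OF Q(1)]) (use P' Q in \<open>auto simp: box_def\<close>)
      then show ?thesis using P'(1) by (simp add: box_def)
    qed
    then show "P \<in> box H G f U \<leadsto>\<^bsub>upset_algebra G\<^esub> box H G f V"
      using P unfolding upset_imp by (simp add: box_def)
  qed
  show "box H G f U \<leadsto>\<^bsub>upset_algebra G\<^esub> box H G f V \<subseteq> box H G f (U \<leadsto>\<^bsub>upset_algebra H\<^esub> V)"
  proof
    fix P assume P: "P \<in> box H G f U \<leadsto>\<^bsub>upset_algebra G\<^esub> box H G f V"
    have Ps: "P \<in> spec G" using P by (simp add: upset_imp)
    have step: "Q \<in> V" if Q: "Q \<in> spec H" "f -` P \<inter> carrier H \<subseteq> Q" "Q \<in> U" for Q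
    proof -
      obtain P' where P': "P' \<in> spec G" "P \<subseteq> P'" "f -` P' \<inter> carrier H = Q"
        using preimage_lifting[OF Ps Q(1,2)] by blast
      have "P' \<in> box H G f U"
        using P' Q U unfolding box_def spec_upset_def by blast
      then have "P' \<in> box H G f V" using P P' by (auto simp: upset_imp)
      then show ?thesis using P'(3) Q(1) by (auto simp: box_def)
    qed
    show "P \<in> box H G f (U \<leadsto>\<^bsub>upset_algebra H\<^esub> V)"
      using Ps step unfolding box_def upset_imp by simp blast
  qed
qed

lemma box_gH_of:
  assumes "U \<in> carrier (gH_of H)"
  shows "box H G f U \<in> carrier (gH_of G)"
proof -
  let ?S = "{U. spec_upset H U \<and> box H G f U \<in> carrier (gH_of G)}"
  have "carrier (gH_of H) \<subseteq> ?S"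
  proof (rule gH_of_induct)
    show "gH_subalgebra (upset_algebra H) ?S"
      using gH_subalgebra_gH_of[of G] gH_subalgebra_carrier[OF gH_algebra_upset[of H]]
      by (auto simp: gH_subalgebra_def box_one box_Int box_Un box_imp)
  qed (simp add: \<phi>_upset box_\<phi> \<phi>_in_gH_of f_simps)
  then show ?thesis using assms by auto
qed

lemma gH_of_map_hom: "gH_of_map H G f \<in> gH_hom (gH_of H) (gH_of G)"
proof -
  have ops: "U \<inter> V \<in> carrier (gH_of H)" "U \<union> V \<in> carrier (gH_of H)"
      "U \<leadsto>\<^bsub>upset_algebra H\<^esub> V \<in> carrier (gH_of H)"
    if "U \<in> carrier (gH_of H)" "V \<in> carrier (gH_of H)" for U V
    using gH_subalgebra_gH_of[of H] that by (simp_all add: gH_subalgebra_def)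
  have eq: "box H G f (U \<union> V) = box H G f U \<union> box H G f V"
    "box H G f (U \<leadsto>\<^bsub>upset_algebra H\<^esub> V) = box H G f U \<leadsto>\<^bsub>upset_algebra G\<^esub> box H G f V"
    if "U \<in> carrier (gH_of H)" "V \<in> carrier (gH_of H)" for U V
    using box_Un box_imp gH_of_upset that by blast+
  have "spec H \<in> carrier (gH_of H)"
    using gH_subalgebra_gH_of[of H] by (simp add: gH_subalgebra_def)
  then show ?thesis
    unfolding gH_hom_def gH_of_map_eq
    by (simp add: ops eq box_gH_of box_one box_Int)
qed

lemma gH_of_map_\<phi>: "a \<in> carrier H \<Longrightarrow> gH_of_map H G f (\<phi> H a) = \<phi> G (f a)"
  by (simp add: gH_of_map_eq \<phi>_in_gH_of box_\<phi>)

end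

section \<open>Generalized Heyting algebras as Hilbert algebras\<close>

context gH_algebra
begin

lemma meet_idem: "a \<in> carrier A \<Longrightarrow> a \<sqinter> a = a"
  using meet_join_absorb[of a "a \<sqinter> a"] join_meet_absorb[of a a] meet_closed by simp

lemma le_trans:
  "a \<in> carrier A \<Longrightarrow> b \<in> carrier A \<Longrightarrow> c \<in> carrier A \<Longrightarrow> a \<sqsubseteq> b \<Longrightarrow> b \<sqsubseteq> c \<Longrightarrow> a \<sqsubseteq> c"
  unfolding gH_le_def using meet_assoc by metis

lemma le_antisym: "a \<in> carrier A \<Longrightarrow> b \<in> carrier A \<Longrightarrow> a \<sqsubseteq> b \<Longrightarrow> b \<sqsubseteq> a \<Longrightarrow> a = b"
  unfolding gH_le_def using meet_commute by metis

lemma meet_le_left: "a \<in> carrier A \<Longrightarrow> b \<in> carrier A \<Longrightarrow> a \<sqinter> b \<sqsubseteq> a"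
  unfolding gH_le_def using meet_assoc meet_commute meet_idem meet_closed by metis

lemma meet_le_right: "a \<in> carrier A \<Longrightarrow> b \<in> carrier A \<Longrightarrow> a \<sqinter> b \<sqsubseteq> b"
  unfolding gH_le_def using meet_assoc meet_idem by metis

lemma meet_greatest:
  "a \<in> carrier A \<Longrightarrow> b \<in> carrier A \<Longrightarrow> c \<in> carrier A \<Longrightarrow> c \<sqsubseteq> a \<Longrightarrow> c \<sqsubseteq> b \<Longrightarrow> c \<sqsubseteq> a \<sqinter> b"
  unfolding gH_le_def using meet_assoc by metis

lemma le_mp:
  assumes "a \<in> carrier A" "b \<in> carrier A" "c \<in> carrier A" "c \<sqsubseteq> a" "c \<sqsubseteq> a \<leadsto> b"
  shows "c \<sqsubseteq> b"
  using le_trans[of c "a \<sqinter> (a \<leadsto> b)" b] meet_greatest[of a "a \<leadsto> b" c] meet_imp_le[of a b] assms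
    meet_closed imp_closed by simp

lemma imp_eq_one_iff_le:
  assumes "a \<in> carrier A" "b \<in> carrier A"
  shows "a \<leadsto> b = \<one> \<longleftrightarrow> a \<sqsubseteq> b"
proof
  assume "a \<leadsto> b = \<one>"
  then show "a \<sqsubseteq> b"
    using le_mp[of a b a] le_one[of a] meet_idem[of a] assms by (simp add: gH_le_def)
next
  assume "a \<sqsubseteq> b"
  then have "\<one> \<sqsubseteq> a \<leadsto> b"
    using le_impI[of a b \<one>] le_one[of a] assms one_closed by (simp add: gH_le_def)
  then show "a \<leadsto> b = \<one>"
    using le_antisym le_one assms imp_closed one_closed by simp
qed

lemma le_iff_join: "a \<in> carrier A \<Longrightarrow> b \<in> carrier A \<Longrightarrow> a \<sqsubseteq> b \<longleftrightarrow> a \<squnion> b = b"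
  unfolding gH_le_def using meet_join_absorb join_meet_absorb meet_commute join_commute by metis

lemma gH_imp_S:
  assumes cl: "a \<in> carrier A" "b \<in> carrier A" "c \<in> carrier A"
  shows "(a \<leadsto> (b \<leadsto> c)) \<leadsto> ((a \<leadsto> b) \<leadsto> (a \<leadsto> c)) = \<one>"
proof -
  let ?x = "a \<leadsto> (b \<leadsto> c)" and ?y = "a \<leadsto> b"
  let ?m = "a \<sqinter> (?y \<sqinter> ?x)"
  note cl' = cl imp_closed meet_closed
  have m: "?m \<sqsubseteq> a" "?m \<sqsubseteq> ?y \<sqinter> ?x"
    using meet_le_left meet_le_right cl' by simp_all
  then have "?m \<sqsubseteq> ?y" "?m \<sqsubseteq> ?x"
    using le_trans[of ?m "?y \<sqinter> ?x"] meet_le_left[of ?y ?x] meet_le_right[of ?y ?x] cl' by simp_all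
  then have "?m \<sqsubseteq> b" "?m \<sqsubseteq> b \<leadsto> c" using le_mp[of a _ ?m] m cl' by simp_all
  then have "?m \<sqsubseteq> c" using le_mp[of b c ?m] cl' by simp
  then have "?x \<sqsubseteq> ?y \<leadsto> (a \<leadsto> c)" using le_impI cl' by simp
  then show ?thesis using imp_eq_one_iff_le cl' by simp
qed

lemma imp_meet_intro:
  "a \<in> carrier A \<Longrightarrow> b \<in> carrier A \<Longrightarrow> a \<leadsto> (b \<leadsto> (a \<sqinter> b)) = \<one>"
  using imp_eq_one_iff_le[of a "b \<leadsto> (a \<sqinter> b)"] le_impI[of b "a \<sqinter> b" a] meet_commute[of a b]
    meet_idem imp_closed meet_closed by (simp add: gH_le_def)

end

lemma forget_simps [simp]:
  "carrier (forget A) = carrier A" "imp (forget A) = imp A"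
  "unit_elt (forget A) = unit_elt A" "join (forget A) = join A"
  by (simp_all add: forget_def)

lemma hilbert_algebra_sup_forget:
  assumes "gH_algebra A"
  shows "hilbert_algebra_sup (forget A)"
proof -
  interpret gH_algebra A by fact
  show ?thesis
  proof unfold_locales
    fix a b assume ab: "a \<in> carrier (forget A)" "b \<in> carrier (forget A)"
    then show "a \<leadsto>\<^bsub>forget A\<^esub> (b \<leadsto>\<^bsub>forget A\<^esub> a) = \<one>\<^bsub>forget A\<^esub>"
      using imp_eq_one_iff_le le_impI meet_le_right imp_closed by simp
    show "a \<leadsto>\<^bsub>forget A\<^esub> b = \<one>\<^bsub>forget A\<^esub> \<longleftrightarrow> a \<squnion>\<^bsub>forget A\<^esub> b = b"
      using ab imp_eq_one_iff_le le_iff_join by simp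
  next
    fix a b assume "a \<in> carrier (forget A)" "b \<in> carrier (forget A)"
      "a \<leadsto>\<^bsub>forget A\<^esub> b = \<one>\<^bsub>forget A\<^esub>" "b \<leadsto>\<^bsub>forget A\<^esub> a = \<one>\<^bsub>forget A\<^esub>"
    then show "a = b" using imp_eq_one_iff_le le_antisym by simp
  next
    fix a assume a: "a \<in> carrier (forget A)"
    then show "a \<squnion>\<^bsub>forget A\<^esub> a = a"
      using le_iff_join[of a a] meet_idem[of a] by (simp add: gH_le_def)
    show "a \<squnion>\<^bsub>forget A\<^esub> \<one>\<^bsub>forget A\<^esub> = \<one>\<^bsub>forget A\<^esub>"
      using a le_iff_join[of a "\<one>\<^bsub>A\<^esub>"] le_one one_closed by simp
  qed (simp_all add: one_closed imp_closed join_closed gH_imp_S join_assoc,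
      simp add: join_commute)
qed

lemma \<phi>_meet:
  assumes A: "gH_algebra A" and ab: "a \<in> carrier A" "b \<in> carrier A"
  shows "\<phi> (forget A) (a \<sqinter>\<^bsub>A\<^esub> b) = \<phi> (forget A) a \<inter> \<phi> (forget A) b"
proof -
  interpret gH_algebra A by fact
  interpret F: hilbert_algebra_sup "forget A" by (rule hilbert_algebra_sup_forget[OF A])
  have "a \<sqinter>\<^bsub>A\<^esub> b \<in> P \<longleftrightarrow> a \<in> P \<and> b \<in> P" if P: "P \<in> spec (forget A)" for P
  proof
    note Pf = F.spec_filter[OF P]
    show "a \<in> P \<and> b \<in> P" if "a \<sqinter>\<^bsub>A\<^esub> b \<in> P"
      using F.filter_up[OF Pf that] imp_eq_one_iff_le meet_le_left meet_le_right meet_closed ab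
      by simp
    assume m: "a \<in> P \<and> b \<in> P"
    then have "b \<leadsto>\<^bsub>A\<^esub> (a \<sqinter>\<^bsub>A\<^esub> b) \<in> P"
      using F.filter_up[OF Pf, of a] imp_meet_intro ab imp_closed meet_closed by simp
    then show "a \<sqinter>\<^bsub>A\<^esub> b \<in> P"
      using F.filter_mp[OF Pf, of b] m ab meet_closed by simp
  qed
  then show ?thesis by (auto simp: \<phi>_def)
qed

text \<open>Because the image of \<open>\<phi>\<close> is closed under all operations of the upset algebra, it is the
  subalgebra that it generates.\<close>

lemma carrier_gH_of_forget:
  assumes A: "gH_algebra A"
  shows "carrier (gH_of (forget A)) = \<phi> (forget A) ` carrier A"
proof
  interpret gH_algebra A by fact
  interpret F: hilbert_algebra_sup "forget A" by (rule hilbert_algebra_sup_forget[OF A])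
  have "gH_subalgebra (upset_algebra (forget A)) (\<phi> (forget A) ` carrier A)"
    unfolding gH_subalgebra_def
  proof (intro conjI ballI)
    show "\<one>\<^bsub>upset_algebra (forget A)\<^esub> \<in> \<phi> (forget A) ` carrier A"
      using F.\<phi>_one one_closed by (auto intro: image_eqI[where x = "\<one>\<^bsub>A\<^esub>"])
  next
    fix U V assume "U \<in> \<phi> (forget A) ` carrier A" "V \<in> \<phi> (forget A) ` carrier A"
    then obtain a b where ab: "a \<in> carrier A" "b \<in> carrier A"
      and UV: "U = \<phi> (forget A) a" "V = \<phi> (forget A) b" by auto
    show "U \<sqinter>\<^bsub>upset_algebra (forget A)\<^esub> V \<in> \<phi> (forget A) ` carrier A"
      using \<phi>_meet[OF A ab] meet_closed[OF ab] UV by (metis imageI upset_algebra_simps(4))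
    show "U \<squnion>\<^bsub>upset_algebra (forget A)\<^esub> V \<in> \<phi> (forget A) ` carrier A"
      using F.\<phi>_join[of a b] join_closed[OF ab] UV ab
      by (metis imageI upset_algebra_simps(3) forget_simps(1,4))
    show "U \<leadsto>\<^bsub>upset_algebra (forget A)\<^esub> V \<in> \<phi> (forget A) ` carrier A"
      using F.\<phi>_imp[of a b] imp_closed[OF ab] UV ab by (metis imageI forget_simps(1,2))
  qed (auto simp: \<phi>_upset)
  then show "carrier (gH_of (forget A)) \<subseteq> \<phi> (forget A) ` carrier A"
    by (rule gH_of_induct) simp
qed (use \<phi>_in_gH_of[of _ "forget A"] in auto)

lemma \<phi>_gH_hom:
  assumes A: "gH_algebra A"
  shows "restrict (\<phi> (forget A)) (carrier A) \<in> gH_hom A (gH_of (forget A))"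
proof -
  interpret gH_algebra A by fact
  interpret F: hilbert_algebra_sup "forget A" by (rule hilbert_algebra_sup_forget[OF A])
  show ?thesis
    using F.\<phi>_one F.\<phi>_join F.\<phi>_imp \<phi>_meet[OF A] \<phi>_in_gH_of[of _ "forget A"]
    by (auto simp: gH_hom_def one_closed meet_closed join_closed imp_closed)
qed

section \<open>The two categories and the two functors\<close>

lemma compose_gH_hom:
  assumes "gH_algebra A" "f \<in> gH_hom A B" "g \<in> gH_hom B C"
  shows "compose (carrier A) g f \<in> gH_hom A C"
proof -
  interpret gH_algebra A by fact
  show ?thesis
    using gH_hom_simps[OF assms(2)] gH_hom_simps[OF assms(3)]
    by (auto simp: gH_hom_def compose_def one_closed meet_closed join_closed imp_closed)
qed

lemma compose_hil_hom:
  assumes "hilbert_algebra_sup A" "f \<in> hil_hom A B" "g \<in> hil_hom B C"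
  shows "compose (carrier A) g f \<in> hil_hom A C"
proof -
  interpret hilbert_algebra_sup A by fact
  show ?thesis
    using hil_hom_simps[OF assms(2)] hil_hom_simps[OF assms(3)]
    by (auto simp: hil_hom_def compose_def one_closed join_closed imp_closed)
qed

lemma id_gH_hom:
  assumes "gH_algebra A"
  shows "(\<lambda>x \<in> carrier A. x) \<in> gH_hom A A"
proof -
  interpret gH_algebra A by fact
  show ?thesis by (auto simp: gH_hom_def one_closed meet_closed join_closed imp_closed)
qed

lemma id_hil_hom:
  assumes "hilbert_algebra_sup A"
  shows "(\<lambda>x \<in> carrier A. x) \<in> hil_hom A A"
proof -
  interpret hilbert_algebra_sup A by fact
  show ?thesis by (auto simp: hil_hom_def one_closed join_closed imp_closed)
qed

lemma inv_into_gH_hom: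
  assumes A: "gH_algebra A" and f: "f \<in> gH_hom A B" and bij: "bij_betw f (carrier A) (carrier B)"
  shows "restrict (inv_into (carrier A) f) (carrier B) \<in> gH_hom B A"
proof -
  interpret gH_algebra A by fact
  let ?g = "inv_into (carrier A) f"
  note f_simps = gH_hom_simps[OF f]
  have inv: "?g (f a) = a" if "a \<in> carrier A" for a
    using bij that by (simp add: bij_betw_def)
  have surj: "\<exists>a \<in> carrier A. x = f a" if "x \<in> carrier B" for x
    using bij that by (auto simp: bij_betw_def)
  have one: "\<one>\<^bsub>B\<^esub> \<in> carrier B" "?g \<one>\<^bsub>B\<^esub> = \<one>\<^bsub>A\<^esub>"
    using f_simps(1) f_simps(5)[of "\<one>\<^bsub>A\<^esub>"] inv[of "\<one>\<^bsub>A\<^esub>"] one_closed by auto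
  have ops: "x \<sqinter>\<^bsub>B\<^esub> y \<in> carrier B \<and> ?g (x \<sqinter>\<^bsub>B\<^esub> y) = ?g x \<sqinter>\<^bsub>A\<^esub> ?g y \<and>
      x \<squnion>\<^bsub>B\<^esub> y \<in> carrier B \<and> ?g (x \<squnion>\<^bsub>B\<^esub> y) = ?g x \<squnion>\<^bsub>A\<^esub> ?g y \<and>
      x \<leadsto>\<^bsub>B\<^esub> y \<in> carrier B \<and> ?g (x \<leadsto>\<^bsub>B\<^esub> y) = ?g x \<leadsto>\<^bsub>A\<^esub> ?g y"
    if xy: "x \<in> carrier B" "y \<in> carrier B" for x y
  proof -
    obtain a b where ab: "a \<in> carrier A" "b \<in> carrier A" "x = f a" "y = f b"
      using surj[OF xy(1)] surj[OF xy(2)] by auto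
    note ops_f = f_simps(2-4)[OF ab(1,2), symmetric]
    show ?thesis
      unfolding ab(3,4) ops_f using inv f_simps(5) ab(1,2) meet_closed join_closed imp_closed
      by simp
  qed
  show ?thesis
    using one ops inv_into_into[of _ f "carrier A"] bij
    by (auto simp: gH_hom_def bij_betw_def)
qed

lemma Hil_cat_simps [simp]:
  "Obj Hil_cat = {H. hilbert_algebra_sup H}" "Hom Hil_cat = hil_hom"
  "Id Hil_cat H = (\<lambda>x \<in> carrier H. x)" "Comp Hil_cat H K L g f = compose (carrier H) g f"
  by (simp_all add: Hil_cat_def)

lemma gH_cat_simps [simp]:
  "Obj gH_cat = {A. gH_algebra A}" "Hom gH_cat = gH_hom"
  "Id gH_cat A = (\<lambda>x \<in> carrier A. x)" "Comp gH_cat A K L g f = compose (carrier A) g f"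
  by (simp_all add: gH_cat_def)

lemma category_Hil_cat: "category Hil_cat"
proof
  fix W X Y Z :: "'a hil" and f g h :: "'a \<Rightarrow> 'a"
  assume "W \<in> Obj Hil_cat" "f \<in> Hom Hil_cat W X"
  then show "Comp Hil_cat W X Z (Comp Hil_cat X Y Z h g) f
      = Comp Hil_cat W Y Z h (Comp Hil_cat W X Y g f)"
    using hil_hom_simps(4) by (fastforce simp: compose_def restrict_def)
next
  fix X Y :: "'a hil" and f
  assume f: "f \<in> Hom Hil_cat X Y"
  have ext: "f \<in> extensional (carrier X)" using f hil_hom_simps(5) by auto
  then show "Comp Hil_cat X X Y f (Id Hil_cat X) = f"
    by (auto simp: compose_def extensional_def)
  show "Comp Hil_cat X Y Y (Id Hil_cat Y) f = f"
    using f ext hil_hom_simps(4) by (fastforce simp: compose_def extensional_def)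
qed (auto intro: id_hil_hom compose_hil_hom)

lemma category_gH_cat: "category gH_cat"
proof
  fix W X Y Z :: "'a gH" and f g h :: "'a \<Rightarrow> 'a"
  assume "W \<in> Obj gH_cat" "f \<in> Hom gH_cat W X"
  then show "Comp gH_cat W X Z (Comp gH_cat X Y Z h g) f
      = Comp gH_cat W Y Z h (Comp gH_cat W X Y g f)"
    using gH_hom_simps(5) by (fastforce simp: compose_def restrict_def)
next
  fix X Y :: "'a gH" and f
  assume f: "f \<in> Hom gH_cat X Y"
  have ext: "f \<in> extensional (carrier X)" using f gH_hom_simps(6) by auto
  then show "Comp gH_cat X X Y f (Id gH_cat X) = f"
    by (auto simp: compose_def extensional_def)
  show "Comp gH_cat X Y Y (Id gH_cat Y) f = f"
    using f ext gH_hom_simps(5) by (fastforce simp: compose_def extensional_def)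
qed (auto intro: id_gH_hom compose_gH_hom)

lemma forget_hom: "f \<in> gH_hom A B \<Longrightarrow> f \<in> hil_hom (forget A) (forget B)"
  by (auto simp: gH_hom_def hil_hom_def)

lemma functor_forget: "cat_functor gH_cat Hil_cat forget forget_map"
  by (intro cat_functor.intro category_gH_cat category_Hil_cat cat_functor_axioms.intro)
    (auto simp: forget_map_def hilbert_algebra_sup_forget forget_hom)

text \<open>Both functor laws equate homomorphisms on \<open>gH_of H\<close>, so it suffices to compare them on the
  generators, where naturality of \<open>\<phi>\<close> computes both sides.\<close>

lemma functor_gH_of: "cat_functor Hil_cat gH_cat gH_of gH_of_map"
proof (intro cat_functor.intro category_gH_cat category_Hil_cat cat_functor_axioms.intro)
  fix X :: "'a hil" assume X: "X \<in> Obj Hil_cat"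
  then interpret hil_morphism X X "\<lambda>x \<in> carrier X. x"
    by (auto simp: hil_morphism_def hil_morphism_axioms_def id_hil_hom)
  show "gH_of_map X X (Id Hil_cat X) = Id gH_cat (gH_of X)"
    unfolding Hil_cat_simps gH_cat_simps
    by (rule gH_hom_eqI[OF gH_of_map_hom id_gH_hom[OF gH_algebra_gH_of]])
      (simp add: gH_of_map_\<phi> \<phi>_in_gH_of)
next
  fix X Y :: "'a hil" and f
  assume "X \<in> Obj Hil_cat" "Y \<in> Obj Hil_cat" "f \<in> Hom Hil_cat X Y"
  then interpret hil_morphism X Y f by (simp add: hil_morphism_def hil_morphism_axioms_def)
  show "gH_of_map X Y f \<in> Hom gH_cat (gH_of X) (gH_of Y)" by (simp add: gH_of_map_hom)
next
  fix X Y Z :: "'a hil" and f g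
  assume XYZ: "X \<in> Obj Hil_cat" "Y \<in> Obj Hil_cat" "Z \<in> Obj Hil_cat"
    and fg: "f \<in> Hom Hil_cat X Y" "g \<in> Hom Hil_cat Y Z"
  interpret f: hil_morphism X Y f using XYZ fg by (simp add: hil_morphism_def hil_morphism_axioms_def)
  interpret g: hil_morphism Y Z g using XYZ fg by (simp add: hil_morphism_def hil_morphism_axioms_def)
  interpret gf: hil_morphism X Z "compose (carrier X) g f"
    using XYZ fg by (simp add: hil_morphism_def hil_morphism_axioms_def
      compose_hil_hom[of X f Y g Z])
  show "gH_of_map X Z (Comp Hil_cat X Y Z g f)
      = Comp gH_cat (gH_of X) (gH_of Y) (gH_of Z) (gH_of_map Y Z g) (gH_of_map X Y f)"
    unfolding Hil_cat_simps gH_cat_simps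
  proof (rule gH_hom_eqI[OF gf.gH_of_map_hom
        compose_gH_hom[OF gH_algebra_gH_of f.gH_of_map_hom g.gH_of_map_hom]])
    fix a assume "a \<in> carrier X"
    then show "gH_of_map X Z (compose (carrier X) g f) (\<phi> X a)
        = compose (carrier (gH_of X)) (gH_of_map Y Z g) (gH_of_map X Y f) (\<phi> X a)"
      by (simp add: compose_eq gf.gH_of_map_\<phi> f.gH_of_map_\<phi> g.gH_of_map_\<phi> f.f_simps \<phi>_in_gH_of)
  qed
qed (simp add: gH_algebra_gH_of)

section \<open>The universal property\<close>

definition restrict_unit :: "'a hil \<Rightarrow> ('a set set \<Rightarrow> 'b) \<Rightarrow> 'a \<Rightarrow> 'b"
  where "restrict_unit H k = compose (carrier H) k (\<phi> H)"

lemma restrict_unit_hom: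
  assumes H: "hilbert_algebra_sup H" and k: "k \<in> gH_hom (gH_of H) A"
  shows "restrict_unit H k \<in> hil_hom H (forget A)"
proof -
  interpret hilbert_algebra_sup H by fact
  show ?thesis
    using gH_hom_simps[OF k] \<phi>_in_gH_of[of _ H]
    by (auto simp: hil_hom_def restrict_unit_def compose_def \<phi>_one \<phi>_join \<phi>_imp
        one_closed join_closed imp_closed)
qed

text \<open>The extension of \<open>h\<close> is \<open>gH_of_map H (forget A) h\<close> followed by the inverse of the isomorphism
  \<open>\<phi>\<close> of \<open>A\<close>; naturality of \<open>\<phi>\<close> at \<open>h\<close> shows that it restricts to \<open>h\<close>.\<close>

lemma restrict_unit_surj:
  assumes H: "hilbert_algebra_sup H" and A: "gH_algebra A" and h: "h \<in> hil_hom H (forget A)"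
  shows "\<exists>k \<in> gH_hom (gH_of H) A. restrict_unit H k = h"
proof -
  interpret hil_morphism H "forget A" h
    using H h hilbert_algebra_sup_forget[OF A] by (simp add: hil_morphism_def hil_morphism_axioms_def)
  let ?p = "restrict (\<phi> (forget A)) (carrier A)"
  let ?q = "restrict (inv_into (carrier A) ?p) (carrier (gH_of (forget A)))"
  let ?k = "compose (carrier (gH_of H)) ?q (gH_of_map H (forget A) h)"
  have bij: "bij_betw ?p (carrier A) (carrier (gH_of (forget A)))"
    using G.inj_\<phi> carrier_gH_of_forget[OF A] by (simp add: bij_betw_def inj_on_def)
  have k: "?k \<in> gH_hom (gH_of H) A"
    by (rule compose_gH_hom[OF gH_algebra_gH_of gH_of_map_hom
          inv_into_gH_hom[OF A \<phi>_gH_hom[OF A] bij]])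
  have q: "?q (\<phi> (forget A) b) = b" if "b \<in> carrier A" for b
    using bij that inv_into_f_f[of ?p "carrier A" b] \<phi>_in_gH_of[of b "forget A"]
    by (simp add: bij_betw_def)
  have "restrict_unit H ?k = h"
  proof (rule extensionalityI[of _ "carrier H"])
    fix a assume a: "a \<in> carrier H"
    have "restrict_unit H ?k a = ?q (gH_of_map H (forget A) h (\<phi> H a))"
      using a by (simp add: restrict_unit_def compose_eq \<phi>_in_gH_of)
    then show "restrict_unit H ?k a = h a"
      using a q[of "h a"] f_simps(4)[OF a] by (simp add: gH_of_map_\<phi>)
  qed (use f_simps in \<open>simp_all add: restrict_unit_def\<close>)
  then show ?thesis using k by blast
qed

lemma restrict_unit_inj: "inj_on (restrict_unit H) (gH_hom (gH_of H) A)"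
proof (rule inj_onI)
  fix k l assume kl: "k \<in> gH_hom (gH_of H) A" "l \<in> gH_hom (gH_of H) A"
    and eq: "restrict_unit H k = restrict_unit H l"
  show "k = l"
  proof (rule gH_hom_eqI[OF kl])
    fix a assume "a \<in> carrier H"
    then show "k (\<phi> H a) = l (\<phi> H a)"
      using fun_cong[OF eq, of a] by (simp add: restrict_unit_def compose_eq)
  qed
qed

lemma bij_betw_restrict_unit:
  assumes "hilbert_algebra_sup H" "gH_algebra A"
  shows "bij_betw (restrict_unit H) (gH_hom (gH_of H) A) (hil_hom H (forget A))"
  unfolding bij_betw_def
  using restrict_unit_inj restrict_unit_hom[OF assms(1)] restrict_unit_surj[OF assms] by blast

lemma restrict_unit_natural:
  assumes H: "hilbert_algebra_sup H" and H': "hilbert_algebra_sup H'" and f: "f \<in> hil_hom H' H"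
  shows "restrict_unit H'
      (compose (carrier (gH_of H')) (compose (carrier (gH_of H)) g k) (gH_of_map H' H f))
    = compose (carrier H') (compose (carrier H) g (restrict_unit H k)) f"
proof -
  interpret hil_morphism H' H f
    using H H' f by (simp add: hil_morphism_def hil_morphism_axioms_def)
  show ?thesis
    unfolding restrict_unit_def
    by (rule extensionalityI[of _ "carrier H'"])
      (simp_all add: compose_eq \<phi>_in_gH_of gH_of_map_\<phi> f_simps)
qed

theorem theorem14:
  shows "left_adjoint
    (gH_of :: 'a hil \<Rightarrow> 'a set set gH) gH_of_map
    (forget :: 'b gH \<Rightarrow> 'b hil) forget_map"
  unfolding left_adjoint_def
proof (intro conjI exI[of _ "\<lambda>H A. restrict_unit H"] ballI functor_gH_of functor_forget)
qed (auto simp: bij_betw_restrict_unit restrict_unit_natural forget_map_def)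

end
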